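(* Let $1\le k\le n$. There is a randomized algorithm that, given ${\textsc{COND}}_k$ access to an unknown distribution $D$ on $[n]$, estimates the support size $|\mathrm{supp}(D)|$ within a multiplicative $6/5$-factor with probability at least $2/3$, while making at most $O\!\left(\frac{n\log\log n}{k}\right)$ queries.
   Context: For a distribution $D$ on $[n]=\{1,\dots,n\}$ and $S\subseteq[n]$, $D(S)=\sum_{i\in S}D(i)$, and $\mathrm{supp}(D)=\{x:D(x)>0\}$. A ${\textsc{COND}}_k$ oracle takes as input any set $S\subseteq[n]$ with $|S|\le k$ (possibly chosen adaptively); if $D(S)>0$ it returns $j\in S$ with probability $D(j)/D(S)$, and if $D(S)=0$ it returns "failure". An estimate $N$ is within a multiplicative $6/5$-factor if $\frac56|\mathrm{supp}(D)|\le N\le\frac65|\mathrm{supp}(D)|$. The guarantee must hold for every distribution $D$ on $[n]$. *)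

theory Defs
  imports "HOL-Probability.Probability"
begin

text \<open>A distribution on \<open>[n]\<close> is a \<open>nat pmf\<close> \<open>D\<close> with \<^term>\<open>set_pmf D \<subseteq> {1..n}\<close>;
  then \<open>D(S)\<close> is \<^term>\<open>measure_pmf.prob D S\<close> and \<open>supp(D)\<close> is \<^term>\<open>set_pmf D\<close>.
  The oracle answer \<^term>\<open>None\<close> stands for ``failure''.\<close>

definition cond_oracle :: "nat pmf \<Rightarrow> nat set \<Rightarrow> nat option pmf" where
  "cond_oracle D S =
     (if measure_pmf.prob D S > 0 then map_pmf Some (cond_pmf D S) else return_pmf None)"

lemma pmf_cond_oracle_Some:
  assumes "measure_pmf.prob D S > 0"
  shows "pmf (cond_oracle D S) (Some j) =
           (if j \<in> S then pmf D j / measure_pmf.prob D S else 0)"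
proof -
  have "set_pmf D \<inter> S \<noteq> {}"
    using assms by (metis less_irrefl measure_pmf_zero_iff)
  with assms show ?thesis
    by (simp add: cond_oracle_def pmf_map_inj' pmf_cond)
qed

text \<open>A randomized adaptive query algorithm with a real output is a strategy tree:
  it stops with an output, submits a query and continues depending on the
  oracle's answer, or uses its own internal randomness.\<close>

datatype cond_alg =
    Output real
  | Query "nat set" "nat option \<Rightarrow> cond_alg"
  | Random "cond_alg pmf"

primrec run :: "nat pmf \<Rightarrow> cond_alg \<Rightarrow> real pmf" where
  "run D (Output N) = return_pmf N"
| "run D (Query S f) = bind_pmf (cond_oracle D S) (\<lambda>r. run D (f r))"
| "run D (Random p) = join_pmf (map_pmf (run D) p)"

text \<open>\<open>cond_algorithm n k q A\<close>: on every execution path \<open>A\<close> makes at most \<open>q\<close> queries,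
  each of them a set \<open>S \<subseteq> [n]\<close> with \<open>|S| \<le> k\<close>.\<close>

inductive cond_algorithm :: "nat \<Rightarrow> nat \<Rightarrow> nat \<Rightarrow> cond_alg \<Rightarrow> bool" for n k where
  Output: "cond_algorithm n k q (Output N)"
| Query: "\<lbrakk>S \<subseteq> {1..n}; card S \<le> k; \<forall>r \<in> insert None (Some ` S). cond_algorithm n k q (f r)\<rbrakk>
    \<Longrightarrow> cond_algorithm n k (Suc q) (Query S f)"
| Random: "(\<forall>A \<in> set_pmf p. cond_algorithm n k q A) \<Longrightarrow> cond_algorithm n k q (Random p)"

definition within_factor :: "real \<Rightarrow> real \<Rightarrow> real \<Rightarrow> bool" where
  "within_factor c s N \<longleftrightarrow> s / c \<le> N \<and> N \<le> c * s"

end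

theory Submission
  imports Defs
begin

text \<open>
  A query reveals whether \<open>S\<close> meets the support, and emptiness of an arbitrary subset of \<open>[n]\<close> is
  decided by at most \<open>n div k + 1\<close> queries to blocks of size at most \<open>k\<close>; it therefore suffices to
  estimate \<open>s = |supp(D)|\<close> with \<open>O(log log n)\<close> emptiness tests. Give every element an
  independent random level that is below \<open>j\<close> with probability \<open>exp (-2 r^j)\<close>, where \<open>r = 10/11\<close>; then the
  set of elements of level at least \<open>j\<close> misses the support with probability \<open>exp (-2 s r^j)\<close>. Take
  a constant number \<open>T\<close> of independent copies and let \<open>J\<close> be the first \<open>j\<close> for which at least a
  fraction \<open>1/e\<close> of them miss the support. These sets are nested in \<open>j\<close>, so this condition is
  monotone in \<open>j\<close>: binary search over \<open>O(log n)\<close> levels finds \<open>J\<close>, and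
  Hoeffding's inequality is needed at only two levels, the last with \<open>2 s r^j \<ge> 6/5\<close> and the first
  with \<open>2 s r^j \<le> 11/12\<close>. If both behave as expected, then \<open>5/6 < 2 s r^J < 6/5\<close>, and
  \<open>1 / (2 r^J)\<close> is the required estimate.
\<close>

section \<open>Query programs\<close>

lemma cond_algorithm_mono:
  "cond_algorithm n k q A \<Longrightarrow> q \<le> q' \<Longrightarrow> cond_algorithm n k q' A"
proof (induction arbitrary: q' rule: cond_algorithm.induct)
  case (Query S q f)
  then obtain q'' where "q' = Suc q''" "q \<le> q''"
    by (cases q') auto
  with Query show ?case
    by (auto intro!: cond_algorithm.Query)
qed (auto intro: cond_algorithm.intros)

text \<open>Failure has probability \<open>1\<close> or \<open>0\<close> according to whether
  \<open>S\<close> misses the support, so a program that looks only for \<open>None\<close> gets a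
  noiseless emptiness test.\<close>

lemma run_Query_eq_None:
  "run D (Query S (\<lambda>r. if r = None then A else B)) =
     run D (if set_pmf D \<inter> S = {} then A else B)"
proof (cases "set_pmf D \<inter> S = {}")
  case True
  then have "measure_pmf.prob D S = 0"
    by (simp add: measure_pmf_zero_iff)
  with True show ?thesis
    by (simp add: cond_oracle_def bind_return_pmf)
next
  case False
  then have "measure_pmf.prob D S > 0"
    by (metis measure_pmf_zero_iff zero_less_measure_iff)
  with False show ?thesis
    by (simp add: cond_oracle_def bind_map_pmf)
qed

text \<open>The rest of the program is passed as a continuation \<open>c\<close>; this sequences
  programs although a \<open>cond_alg\<close> tree carries its outputs only at the leaves.\<close>

fun test_all_empty :: "nat set list \<Rightarrow> (bool \<Rightarrow> cond_alg) \<Rightarrow> cond_alg" where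
  "test_all_empty [] c = c True"
| "test_all_empty (S # Ss) c =
     Query S (\<lambda>r. if r = None then test_all_empty Ss c else c False)"

lemma run_test_all_empty:
  "run D (test_all_empty Ss c) = run D (c (\<forall>S\<in>set Ss. set_pmf D \<inter> S = {}))"
  by (induction Ss) (simp_all add: run_Query_eq_None del: run.simps)

lemma cond_algorithm_test_all_empty:
  assumes "\<forall>S\<in>set Ss. S \<subseteq> {1..n} \<and> card S \<le> k" "\<And>b. cond_algorithm n k q (c b)"
  shows "cond_algorithm n k (length Ss + q) (test_all_empty Ss c)"
  using assms(1)
proof (induction Ss)
  case (Cons S Ss)
  then show ?case
    \<comment> \<open>Stopping early at a set that meets the support leaves queries over;
      monotonicity fills up the budget.\<close>
    using cond_algorithm_mono[OF assms(2), of "length Ss + q"]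
    by (auto intro!: cond_algorithm.Query)
qed (simp add: assms(2))

fun count_empty :: "nat set list list \<Rightarrow> (nat \<Rightarrow> cond_alg) \<Rightarrow> cond_alg" where
  "count_empty [] c = c 0"
| "count_empty (Ss # Sss) c =
     test_all_empty Ss (\<lambda>b. count_empty Sss (\<lambda>m. c (if b then Suc m else m)))"

lemma run_count_empty:
  "run D (count_empty Sss c) =
     run D (c (length (filter (\<lambda>Ss. \<forall>S\<in>set Ss. set_pmf D \<inter> S = {}) Sss)))"
  by (induction Sss arbitrary: c) (auto simp: run_test_all_empty)

lemma cond_algorithm_count_empty:
  assumes "\<forall>Ss\<in>set Sss. length Ss = l \<and> (\<forall>S\<in>set Ss. S \<subseteq> {1..n} \<and> card S \<le> k)"
    and "\<And>m. cond_algorithm n k q (c m)"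
  shows "cond_algorithm n k (length Sss * l + q) (count_empty Sss c)"
  using assms
proof (induction Sss arbitrary: c)
  case (Cons Ss Sss)
  have "cond_algorithm n k (length Ss + (length Sss * l + q)) (count_empty (Ss # Sss) c)"
    unfolding count_empty.simps
    by (intro cond_algorithm_test_all_empty Cons.IH) (use Cons.prems in auto)
  with Cons.prems show ?case
    by (simp add: add.assoc)
qed simp

section \<open>Binary search and splitting into blocks\<close>

fun binary_search ::
  "(nat \<Rightarrow> (bool \<Rightarrow> cond_alg) \<Rightarrow> cond_alg) \<Rightarrow> (nat \<Rightarrow> cond_alg) \<Rightarrow> nat \<Rightarrow> nat \<Rightarrow> cond_alg" where
  "binary_search test out 0 lo = out (Suc lo)"
| "binary_search test out (Suc d) lo =
     test (lo + 2 ^ d) (\<lambda>b. binary_search test out d (if b then lo else lo + 2 ^ d))"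

text \<open>Invariant: \<open>P\<close> fails at the lower end and holds at the upper end of an
  interval of length \<open>2 ^ d\<close>. Either outcome at the midpoint preserves this on one
  half, and for \<open>d = 0\<close> the two ends are adjacent.\<close>

lemma run_binary_search:
  assumes "\<And>m c. run D (test m c) = run D (c (P m))" "\<not> P lo" "P (lo + 2 ^ d)"
  shows "\<exists>j. P (Suc j) \<and> \<not> P j \<and> run D (binary_search test out d lo) = run D (out (Suc j))"
  using assms(2,3)
proof (induction d arbitrary: lo)
  case (Suc d)
  show ?case
  proof (cases "P (lo + 2 ^ d)")
    case True
    then show ?thesis
      using Suc.IH[of lo] Suc.prems by (simp add: assms(1))
  next
    case False
    then show ?thesis
      using Suc.IH[of "lo + 2 ^ d"] Suc.prems by (simp add: assms(1) mult_2 add.assoc)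
  qed
qed auto

lemma cond_algorithm_binary_search:
  assumes "\<And>m q c. (\<And>b. cond_algorithm n k q (c b)) \<Longrightarrow> cond_algorithm n k (l + q) (test m c)"
    and "\<And>j. cond_algorithm n k 0 (out j)"
  shows "cond_algorithm n k (d * l) (binary_search test out d lo)"
  by (induction d arbitrary: lo) (simp_all add: assms)

text \<open>The intervals start at \<open>0\<close>, so \<open>i\<close> lies in block
  \<open>i div k\<close> and the element \<open>n\<close> in block \<open>n div k\<close>; hence the
  \<open>Suc\<close>.\<close>

definition blocks :: "nat \<Rightarrow> nat \<Rightarrow> nat set \<Rightarrow> nat set list" where
  "blocks n k S = map (\<lambda>b. S \<inter> {b * k..<b * k + k}) [0..<Suc (n div k)]"

lemma length_blocks [simp]: "length (blocks n k S) = Suc (n div k)"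
  by (simp add: blocks_def)

lemma blocks_subset_card:
  assumes "S \<subseteq> {1..n}" "B \<in> set (blocks n k S)"
  shows "B \<subseteq> {1..n} \<and> card B \<le> k"
proof -
  from assms(2) obtain b where B: "B = S \<inter> {b * k..<b * k + k}"
    by (auto simp: blocks_def)
  then have "card B \<le> card {b * k..<b * k + k}"
    by (intro card_mono) auto
  with B assms(1) show ?thesis
    by auto
qed

lemma Union_blocks:
  assumes "S \<subseteq> {1..n}" "k \<ge> 1"
  shows "\<Union> (set (blocks n k S)) = S"
proof
  show "S \<subseteq> \<Union> (set (blocks n k S))"
  proof
    fix i assume i: "i \<in> S"
    have "i \<in> {i div k * k..<i div k * k + k}"
      using assms(2) dividend_less_div_times[of k i] by (simp add: add.commute)
    moreover have "i div k < Suc (n div k)"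
      using i assms(1) by (auto intro!: div_le_mono simp: less_Suc_eq_le)
    then have "S \<inter> {i div k * k..<i div k * k + k} \<in> set (blocks n k S)"
      unfolding blocks_def set_map set_upt by (intro imageI) simp
    ultimately show "i \<in> \<Union> (set (blocks n k S))"
      using i by blast
  qed
qed (auto simp: blocks_def)

section \<open>Random levels\<close>

text \<open>The increments of \<open>F\<close> are nonnegative and telescope to \<open>1\<close>, so
  they form the required mass function.\<close>

lemma ex_pmf_nat_cdf:
  fixes F :: "nat \<Rightarrow> real"
  assumes "mono F" "F 0 = 0" "F \<longlonglongrightarrow> 1"
  shows "\<exists>p. \<forall>j. measure_pmf.prob p {..<j} = F j"
proof -
  define f where "f j = F (Suc j) - F j" for j
  have nonneg: "f j \<ge> 0" for j
    using assms(1) by (simp add: f_def mono_def)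
  have "f sums 1"
    using telescope_sums[OF assms(3)] assms(2) by (simp add: f_def[abs_def])
  then have total: "(\<integral>\<^sup>+j. ennreal (f j) \<partial>count_space UNIV) = 1"
    unfolding nn_integral_count_space_nat by (subst suminf_ennreal_eq[OF nonneg]) auto
  have "pmf (embed_pmf f) j = f j" for j
    by (rule pmf_embed_pmf[OF nonneg total])
  then have "measure_pmf.prob (embed_pmf f) {..<j} = F j" for j
    using assms(2) by (simp add: measure_measure_pmf_finite f_def sum_lessThan_telescope)
  then show ?thesis
    by blast
qed

lemma ex_level_pmf:
  fixes r :: real
  assumes "0 < r" "r < 1" "a > 0"
  shows "\<exists>p. \<forall>j\<ge>1. measure_pmf.prob p {..<j} = exp (- (a * r ^ j))"
proof -
  \<comment> \<open>At \<open>j = 0\<close> the formula would give \<open>exp (- a) > 0\<close>, but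
    \<open>{..<0}\<close> is empty. So \<open>F 0\<close> is set to \<open>0\<close>, and level
    \<open>0\<close> receives the mass \<open>exp (- (a * r))\<close>.\<close>
  define F where "F j = (if j = 0 then 0 else exp (- (a * r ^ j)))" for j :: nat
  have "mono F"
    using assms by (auto simp: mono_def F_def intro!: power_decreasing)
  moreover have "F \<longlonglongrightarrow> 1"
  proof (rule Lim_transform_eventually)
    have "(\<lambda>j. exp (- (a * r ^ j))) \<longlonglongrightarrow> exp (- (a * 0))"
      by (intro tendsto_intros LIMSEQ_power_zero) (use assms in auto)
    then show "(\<lambda>j. exp (- (a * r ^ j))) \<longlonglongrightarrow> 1"
      by simp
    show "\<forall>\<^sub>F j in sequentially. exp (- (a * r ^ j)) = F j"
      using eventually_gt_at_top[of 0] by eventually_elim (simp add: F_def)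
  qed
  ultimately obtain p where p: "\<And>j. measure_pmf.prob p {..<j} = F j"
    using ex_pmf_nat_cdf[of F] by (auto simp: F_def)
  then show ?thesis
    by (intro exI[of _ p]) (simp add: F_def)
qed

text \<open>Coordinates outside \<open>U\<close> are unconstrained and give factors
  \<open>1\<close>; the others multiply by independence. If a level is below \<open>j\<close> with
  probability \<open>exp (- x)\<close>, the power is \<open>exp (- (card U * x))\<close>, so only
  the size of \<open>U\<close> matters.\<close>

lemma prob_Pi_pmf_all_less:
  fixes p :: "nat pmf"
  assumes "finite A" "U \<subseteq> A"
  shows "measure_pmf.prob (Pi_pmf A d (\<lambda>_. p)) {Y. \<forall>i\<in>U. Y i < j} =
           measure_pmf.prob p {..<j} ^ card U"
proof -
  have "{Y. \<forall>i\<in>U. Y i < j} = Pi A (\<lambda>i. if i \<in> U then {..<j} else UNIV)"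
    using assms(2) by (auto simp: Pi_def split: if_splits)
  also have "measure_pmf.prob (Pi_pmf A d (\<lambda>_. p)) \<dots> =
      (\<Prod>i\<in>A. measure_pmf.prob p (if i \<in> U then {..<j} else UNIV))"
    using assms(1) by (rule measure_Pi_pmf_Pi)
  also have "\<dots> = (\<Prod>i\<in>A. if i \<in> U then measure_pmf.prob p {..<j} else 1)"
    by (intro prod.cong) auto
  also have "\<dots> = (\<Prod>i\<in>A \<inter> U. measure_pmf.prob p {..<j})"
    using assms(1) by (simp add: prod.If_cases)
  also have "A \<inter> U = U"
    using assms(2) by blast
  finally show ?thesis
    by simp
qed

section \<open>Concentration over independent copies\<close>

lemma map_pmf_mem_eq_bernoulli:
  "map_pmf (\<lambda>y. y \<in> E) Q = bernoulli_pmf (measure_pmf.prob Q E)"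
proof (rule pmf_eqI)
  fix b
  have "measure_pmf.prob Q (- E) = 1 - measure_pmf.prob Q E"
    using measure_pmf.prob_compl[of E Q] by (simp add: Compl_eq_Diff_UNIV)
  then show "pmf (map_pmf (\<lambda>y. y \<in> E) Q) b = pmf (bernoulli_pmf (measure_pmf.prob Q E)) b"
    by (cases b) (simp_all add: pmf_map vimage_def Compl_eq)
qed

lemma map_pmf_card_Pi_pmf_binomial:
  assumes "finite I"
  shows "map_pmf (\<lambda>X. card {t\<in>I. X t \<in> E}) (Pi_pmf I d (\<lambda>_. Q)) =
           binomial_pmf (card I) (measure_pmf.prob Q E)"
proof -
  \<comment> \<open>The default \<open>d \<in> E\<close> is the image of \<open>d\<close> under
    membership in \<open>E\<close>, as \<open>Pi_pmf_map\<close> demands.\<close>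
  have "binomial_pmf (card I) (measure_pmf.prob Q E) =
      map_pmf (\<lambda>f. card {t\<in>I. f t}) (Pi_pmf I (d \<in> E) (\<lambda>_. map_pmf (\<lambda>y. y \<in> E) Q))"
    unfolding map_pmf_mem_eq_bernoulli using assms by (intro binomial_pmf_altdef') auto
  also have "\<dots> = map_pmf (\<lambda>f. card {t\<in>I. f t}) (map_pmf (\<lambda>h. (\<lambda>y. y \<in> E) \<circ> h) (Pi_pmf I d (\<lambda>_. Q)))"
    using assms by (subst Pi_pmf_map[where dflt = d]) auto
  finally show ?thesis
    by (simp add: map_pmf_comp)
qed

lemma Hoeffding_Pi_pmf_count:
  fixes Q :: "'b pmf" and E :: "'b set" and \<epsilon> :: real
  assumes "finite I" "I \<noteq> {}" "\<epsilon> \<ge> 0"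
  defines "\<mu> \<equiv> real (card I) * measure_pmf.prob Q E"
  shows "measure_pmf.prob (Pi_pmf I d (\<lambda>_. Q)) {X. real (card {t\<in>I. X t \<in> E}) \<ge> \<mu> + \<epsilon>}
           \<le> exp (- 2 * \<epsilon>\<^sup>2 / real (card I))" (is ?ge)
    and "measure_pmf.prob (Pi_pmf I d (\<lambda>_. Q)) {X. real (card {t\<in>I. X t \<in> E}) \<le> \<mu> - \<epsilon>}
           \<le> exp (- 2 * \<epsilon>\<^sup>2 / real (card I))" (is ?le)
proof -
  interpret binomial_distribution "card I" "measure_pmf.prob Q E"
    by unfold_locales auto
  have count: "measure_pmf.prob (Pi_pmf I d (\<lambda>_. Q)) {X. R (card {t\<in>I. X t \<in> E})} =
      measure_pmf.prob (binomial_pmf (card I) (measure_pmf.prob Q E)) {m. R m}" for R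
    unfolding map_pmf_card_Pi_pmf_binomial[OF assms(1), of E d, symmetric]
    by (simp add: vimage_def)
  have "card I > 0"
    using assms(1,2) by (simp add: card_gt_0_iff)
  then show ?ge ?le
    unfolding \<mu>_def
    using prob_ge[of \<epsilon>] prob_le[of \<epsilon>] assms(3)
      count[of "\<lambda>m. real m \<ge> real (card I) * measure_pmf.prob Q E + \<epsilon>"]
      count[of "\<lambda>m. real m \<le> real (card I) * measure_pmf.prob Q E - \<epsilon>"]
    by simp_all
qed

section \<open>The estimator\<close>

text \<open>\<open>U\<close> stands for the support. The threshold \<open>exp (- 1)\<close> is the
  probability that a copy misses it when \<open>card U * (2 * (10 / 11) ^ j)\<close> equals
  \<open>1\<close>, the crossing point to be located.\<close>

definition mostly_empty :: "nat \<Rightarrow> nat set \<Rightarrow> (nat \<Rightarrow> nat \<Rightarrow> nat) \<Rightarrow> nat \<Rightarrow> bool" where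
  "mostly_empty T U X j \<longleftrightarrow>
     exp (- 1) * real T \<le> real (card {t\<in>{..<T}. X t \<in> {Y. \<forall>i\<in>U. Y i < j}})"

text \<open>The same seeds \<open>X\<close> serve all levels, so raising \<open>j\<close> only
  weakens the conditions \<open>Y i < j\<close>. This coupling is why controlling two levels
  suffices.\<close>

lemma mostly_empty_mono:
  assumes "mostly_empty T U X j" "j \<le> j'"
  shows "mostly_empty T U X j'"
proof -
  have "card {t\<in>{..<T}. X t \<in> {Y. \<forall>i\<in>U. Y i < j}} \<le> card {t\<in>{..<T}. X t \<in> {Y. \<forall>i\<in>U. Y i < j'}}"
    using assms(2) by (intro card_mono) (auto dest: less_le_trans)
  with assms(1) show ?thesis
    unfolding mostly_empty_def by linarith
qed

lemma not_mostly_empty_0: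
  assumes "U \<noteq> {}" "T > 0"
  shows "\<not> mostly_empty T U X 0"
  using assms by (auto simp: mostly_empty_def not_le)

definition level_test ::
  "nat \<Rightarrow> nat \<Rightarrow> nat \<Rightarrow> (nat \<Rightarrow> nat \<Rightarrow> nat) \<Rightarrow> nat \<Rightarrow> (bool \<Rightarrow> cond_alg) \<Rightarrow> cond_alg" where
  "level_test n k T X j c =
     count_empty (map (\<lambda>t. blocks n k {i\<in>{1..n}. j \<le> X t i}) [0..<T])
       (\<lambda>m. c (exp (- 1) * real T \<le> real m))"

text \<open>A set misses the support iff all its blocks do, and the elements of level at least
  \<open>j\<close> miss it iff every supported element has level below \<open>j\<close>. For fixed
  \<open>X\<close> the test is therefore deterministic.\<close>

lemma run_level_test:
  assumes "set_pmf D \<subseteq> {1..n}" "k \<ge> 1"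
  shows "run D (level_test n k T X j c) = run D (c (mostly_empty T (set_pmf D) X j))"
proof -
  have empty_iff: "(\<forall>B\<in>set (blocks n k S). set_pmf D \<inter> B = {}) \<longleftrightarrow> set_pmf D \<inter> S = {}"
    if "S \<subseteq> {1..n}" for S
  proof -
    have "set_pmf D \<inter> S = (\<Union>B\<in>set (blocks n k S). set_pmf D \<inter> B)"
      using Union_blocks[OF that assms(2)] by blast
    then show ?thesis
      by auto
  qed
  have "(\<forall>B\<in>set (blocks n k {i\<in>{1..n}. j \<le> X t i}). set_pmf D \<inter> B = {}) \<longleftrightarrow>
      X t \<in> {Y. \<forall>i\<in>set_pmf D. Y i < j}" for t
    using assms(1) by (subst empty_iff) (auto simp: not_le disjoint_iff subset_iff)
  moreover have "length (filter R [0..<T]) = card {t\<in>{..<T}. R t}" for R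
    by (subst distinct_card[symmetric]) (auto intro: arg_cong[where f = card])
  ultimately show ?thesis
    by (simp add: level_test_def run_count_empty filter_map o_def mostly_empty_def)
qed

lemma cond_algorithm_level_test:
  assumes "\<And>b. cond_algorithm n k q (c b)"
  shows "cond_algorithm n k (T * Suc (n div k) + q) (level_test n k T X j c)"
proof -
  have "cond_algorithm n k
      (length (map (\<lambda>t. blocks n k {i\<in>{1..n}. j \<le> X t i}) [0..<T]) * Suc (n div k) + q)
      (level_test n k T X j c)"
    unfolding level_test_def
  proof (rule cond_algorithm_count_empty)
    have "B \<subseteq> {1..n} \<and> card B \<le> k" if "B \<in> set (blocks n k {i\<in>{1..n}. j \<le> X t i})" for B t
      using that by (intro blocks_subset_card) auto
    then show "\<forall>Ss\<in>set (map (\<lambda>t. blocks n k {i\<in>{1..n}. j \<le> X t i}) [0..<T]).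
        length Ss = Suc (n div k) \<and> (\<forall>S\<in>set Ss. S \<subseteq> {1..n} \<and> card S \<le> k)"
      by auto
  qed (rule assms)
  then show ?thesis
    by simp
qed

text \<open>The output is the solution \<open>s\<close> of
  \<open>s * (2 * (10 / 11) ^ j) = 1\<close>.\<close>

definition support_search :: "nat \<Rightarrow> nat \<Rightarrow> nat \<Rightarrow> nat \<Rightarrow> (nat \<Rightarrow> nat \<Rightarrow> nat) \<Rightarrow> cond_alg" where
  "support_search n k T d X =
     binary_search (level_test n k T X) (\<lambda>j. Output (1 / (2 * (10 / 11) ^ j))) d 0"

lemma cond_algorithm_support_search:
  "cond_algorithm n k (d * (T * Suc (n div k))) (support_search n k T d X)"
  unfolding support_search_def
  by (intro cond_algorithm_binary_search cond_algorithm_level_test cond_algorithm.Output)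

definition level_seeds :: "nat \<Rightarrow> nat \<Rightarrow> nat pmf \<Rightarrow> (nat \<Rightarrow> nat \<Rightarrow> nat) pmf" where
  "level_seeds n T p = Pi_pmf {..<T} (\<lambda>_. 0) (\<lambda>_. Pi_pmf {1..n} 0 (\<lambda>_. p))"

text \<open>The expected count differs from the threshold \<open>T/e\<close> by at least \<open>T/36 = 108\<close>, and
  \<open>T = 3888\<close> makes Hoeffding's bound equal to \<open>exp (-6)\<close>.\<close>

lemma prob_mostly_empty:
  fixes p :: "nat pmf"
  assumes p: "measure_pmf.prob p {..<j} = exp (- (2 * (10 / 11) ^ j))"
    and U: "U \<subseteq> {1..n}" and T: "T = 3888"
  shows "real (card U) * (2 * (10 / 11) ^ j) \<ge> 6 / 5 \<Longrightarrow>
           measure_pmf.prob (level_seeds n T p) {X. mostly_empty T U X j} \<le> 1 / 6"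
    and "real (card U) * (2 * (10 / 11) ^ j) \<le> 11 / 12 \<Longrightarrow>
           measure_pmf.prob (level_seeds n T p) {X. \<not> mostly_empty T U X j} \<le> 1 / 6"
proof -
  define \<rho> :: real where "\<rho> = real (card U) * (2 * (10 / 11) ^ j)"
  define Q where "Q = Pi_pmf {1..n} (0 :: nat) (\<lambda>_. p)"
  define E where "E = {Y :: nat \<Rightarrow> nat. \<forall>i\<in>U. Y i < j}"
  have Q: "measure_pmf.prob Q E = exp (- \<rho>)"
    using prob_Pi_pmf_all_less[OF _ U, of 0 p j]
    by (simp add: Q_def E_def p \<rho>_def exp_of_nat_mult[symmetric])
  have "T > 0"
    using T by simp
  then have T0: "finite {..<T}" "{..<T} \<noteq> {}" "(0::real) \<le> 108"
    by auto
  have "exp (6::real) \<ge> 6"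
    using exp_ge_add_one_self[of "6::real"] by simp
  then have "exp (- 6 :: real) \<le> 1 / 6"
    by (simp add: exp_minus field_simps)
  moreover have "- 2 * 108\<^sup>2 / real (card {..<T}) = - 6"
    using T by simp
  ultimately have Hoeffding:
    "measure_pmf.prob (level_seeds n T p)
       {X. real (card {t\<in>{..<T}. X t \<in> E}) \<ge> real T * exp (- \<rho>) + 108} \<le> 1 / 6"
    "measure_pmf.prob (level_seeds n T p)
       {X. real (card {t\<in>{..<T}. X t \<in> E}) \<le> real T * exp (- \<rho>) - 108} \<le> 1 / 6"
    using Hoeffding_Pi_pmf_count[OF T0, of "\<lambda>_. 0" Q E]
    unfolding level_seeds_def Q_def[symmetric] Q by simp_all
  \<comment> \<open>This turns relative gaps into absolute ones: the factors \<open>5 / 6\<close>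
    and \<open>13 / 12\<close> below move the mean away from \<open>T / e\<close> by at least
    \<open>T / 18\<close> and \<open>T / 36\<close>.\<close>
  have e1: "exp (- 1 :: real) \<ge> 1 / 3"
    using exp_le by (simp add: exp_minus field_simps)
  {
    assume "real (card U) * (2 * (10 / 11) ^ j) \<ge> 6 / 5"
    then have "exp (- \<rho>) \<le> exp (- 1 + - (1 / 5))"
      by (simp add: \<rho>_def)
    also have "\<dots> = exp (- 1) * exp (- (1 / 5))"
      by (rule exp_add)
    also have "exp (- (1 / 5) :: real) \<le> 5 / 6"
      using exp_ge_add_one_self[of "1 / 5 :: real"] by (simp add: exp_minus field_simps)
    finally have "real T * exp (- \<rho>) + 108 \<le> exp (- 1) * real T"
      using e1 T by simp
    then have "{X. mostly_empty T U X j} \<subseteq>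
        {X. real (card {t\<in>{..<T}. X t \<in> E}) \<ge> real T * exp (- \<rho>) + 108}"
      unfolding mostly_empty_def E_def[symmetric] by auto
    then show "measure_pmf.prob (level_seeds n T p) {X. mostly_empty T U X j} \<le> 1 / 6"
      by (intro order_trans[OF measure_pmf.finite_measure_mono Hoeffding(1)]) auto
  next
    assume "real (card U) * (2 * (10 / 11) ^ j) \<le> 11 / 12"
    then have "exp (- 1 + 1 / 12) \<le> exp (- \<rho>)"
      by (simp add: \<rho>_def)
    moreover have "exp (- 1 + 1 / 12 :: real) = exp (- 1) * exp (1 / 12)"
      by (rule exp_add)
    moreover have "exp (- 1) * (13 / 12) \<le> exp (- 1) * exp (1 / 12 :: real)"
      using exp_ge_add_one_self[of "1 / 12 :: real"] by simp
    ultimately have "exp (- 1) * (13 / 12) \<le> exp (- \<rho>)"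
      by linarith
    then have "exp (- 1) * real T \<le> real T * exp (- \<rho>) - 108"
      using e1 T by simp
    then have "{X. \<not> mostly_empty T U X j} \<subseteq>
        {X. real (card {t\<in>{..<T}. X t \<in> E}) \<le> real T * exp (- \<rho>) - 108}"
      unfolding mostly_empty_def E_def[symmetric] by auto
    then show "measure_pmf.prob (level_seeds n T p) {X. \<not> mostly_empty T U X j} \<le> 1 / 6"
      by (intro order_trans[OF measure_pmf.finite_measure_mono Hoeffding(2)]) auto
  }
qed

text \<open>For fixed good seeds nothing is random any more. Monotonicity forces the switch found by
  the search to satisfy \<open>Suc j > lo\<close> and \<open>j < hi\<close>, whatever happens at the
  levels between \<open>lo\<close> and \<open>hi\<close>.\<close>

lemma run_support_search:
  assumes D: "set_pmf D \<subseteq> {1..n}" "k \<ge> 1" and T: "T > 0"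
    and s: "s = real (card (set_pmf D))"
    and lo: "\<And>j. j > lo \<Longrightarrow> s * (2 * (10 / 11) ^ j) < 6 / 5"
    and hi: "\<And>j. j < hi \<Longrightarrow> s * (2 * (10 / 11) ^ j) > 11 / 12" "hi \<le> 2 ^ d"
    and X: "\<not> mostly_empty T (set_pmf D) X lo" "mostly_empty T (set_pmf D) X hi"
  shows "\<exists>N. within_factor (6 / 5) s N \<and> run D (support_search n k T d X) = return_pmf N"
proof -
  have "\<not> mostly_empty T (set_pmf D) X 0"
    using T by (intro not_mostly_empty_0 set_pmf_not_empty)
  moreover have "mostly_empty T (set_pmf D) X (0 + 2 ^ d)"
    using X(2) hi(2) mostly_empty_mono by auto
  ultimately obtain j where j: "mostly_empty T (set_pmf D) X (Suc j)" "\<not> mostly_empty T (set_pmf D) X j"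
    and run: "run D (support_search n k T d X) = return_pmf (1 / (2 * (10 / 11) ^ Suc j))"
    using run_binary_search[where D = D and test = "level_test n k T X"
        and P = "mostly_empty T (set_pmf D) X" and lo = 0 and d = d, OF run_level_test[OF D]]
    unfolding support_search_def by (metis run.simps(1))
  define x :: real where "x = 2 * (10 / 11) ^ Suc j"
  have "x > 0"
    by (simp add: x_def)
  have "Suc j > lo"
    using j(1) X(1) mostly_empty_mono by (meson not_le)
  then have "s * x < 6 / 5"
    unfolding x_def by (rule lo)
  have "j < hi"
    using j(2) X(2) mostly_empty_mono by (meson not_le)
  then have "s * (2 * (10 / 11) ^ j) > 11 / 12"
    by (rule hi)
  \<comment> \<open>The lower bound is known one level earlier, at \<open>j\<close>; passing to
    \<open>Suc j\<close> costs a factor \<open>10 / 11\<close>, and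
    \<open>11 / 12 * (10 / 11) = 5 / 6\<close>.\<close>
  then have "s * x > 5 / 6"
    by (simp add: x_def)
  with \<open>x > 0\<close> \<open>s * x < 6 / 5\<close> have "within_factor (6 / 5) s (1 / x)"
    by (simp add: within_factor_def field_simps)
  with run show ?thesis
    unfolding x_def by blast
qed

section \<open>Success probability\<close>

lemma measure_bind_pmf_ge:
  assumes "\<And>x. x \<in> E \<Longrightarrow> set_pmf (f x) \<subseteq> G"
  shows "measure_pmf.prob M E \<le> measure_pmf.prob (bind_pmf M f) G"
proof -
  have "emeasure (measure_pmf M) E = (\<integral>\<^sup>+x. indicator E x \<partial>measure_pmf M)"
    by simp
  also have "\<dots> \<le> (\<integral>\<^sup>+x. emeasure (measure_pmf (f x)) G \<partial>measure_pmf M)"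
  proof (intro nn_integral_mono)
    fix x
    show "indicator E x \<le> emeasure (measure_pmf (f x)) G"
    proof (cases "x \<in> E")
      case True
      then have "AE y in measure_pmf (f x). y \<in> G"
        using assms by (auto simp: AE_measure_pmf_iff)
      then have "emeasure (measure_pmf (f x)) G = 1"
        by (intro measure_pmf.emeasure_eq_1_AE) auto
      then show ?thesis
        by (simp add: indicator_def)
    qed simp
  qed
  also have "\<dots> = emeasure (measure_pmf (bind_pmf M f)) G"
    by simp
  finally show ?thesis
    by (simp add: measure_pmf.emeasure_eq_measure)
qed

lemma prob_run_support_search:
  assumes p: "\<And>j. j \<ge> 1 \<Longrightarrow> measure_pmf.prob p {..<j} = exp (- (2 * (10 / 11) ^ j))"
    and D: "set_pmf D \<subseteq> {1..n}" "k \<ge> 1" and T: "T = 3888"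
    and d: "real n * (2 * (10 / 11) ^ 2 ^ d) \<le> 11 / 12"
  shows "measure_pmf.prob (run D (Random (map_pmf (support_search n k T d) (level_seeds n T p))))
           {N. within_factor (6 / 5) (real (card (set_pmf D))) N} \<ge> 2 / 3"
proof -
  define U where "U = set_pmf D"
  define s where "s = real (card U)"
  define G where "G = {N. within_factor (6 / 5) s N}"
  define M where "M = level_seeds n T p"
  have "finite U"
    using D(1) by (auto simp: U_def intro: finite_subset)
  then have "s \<ge> 1"
    using set_pmf_not_empty[of D] by (simp add: s_def U_def Suc_le_eq card_gt_0_iff)
  have "card U \<le> n"
    using card_mono[OF _ D(1)] by (simp add: U_def)
  define \<rho> where "\<rho> j = s * (2 * (10 / 11) ^ j)" for j :: nat
  have anti: "\<rho> j' \<le> \<rho> j" if "j \<le> j'" for j j'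
    using \<open>s \<ge> 1\<close> that by (auto simp: \<rho>_def intro!: mult_left_mono power_decreasing)
  have "\<rho> (2 ^ d) \<le> real n * (2 * (10 / 11) ^ 2 ^ d)"
    using \<open>card U \<le> n\<close> by (auto simp: \<rho>_def s_def intro!: mult_right_mono)
  with d have last: "\<rho> (2 ^ d) \<le> 11 / 12"
    by linarith
  define hi where "hi = (LEAST j. \<rho> j \<le> 11 / 12)"
  have hi: "\<rho> hi \<le> 11 / 12" "hi \<le> 2 ^ d"
    using last by (auto simp: hi_def intro: LeastI Least_le)
  have less_hi: "\<rho> j > 11 / 12" if "j < hi" for j
    using not_less_Least[OF that[unfolded hi_def]] by simp
  \<comment> \<open>The predecessor of \<open>m\<close> will be \<open>lo\<close>, the last level
    with \<open>\<rho> \<ge> 6 / 5\<close>.\<close>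
  define m where "m = (LEAST j. \<rho> j < 6 / 5)"
  have m: "\<rho> m < 6 / 5"
    unfolding m_def by (rule LeastI[of _ "2 ^ d"]) (use last in simp)
  \<comment> \<open>Here the factor \<open>2\<close> in the level law pays off:
    \<open>\<rho> 1 = 20 / 11 * s\<close> exceeds \<open>6 / 5\<close> even for
    \<open>s = 1\<close>. So \<open>lo \<ge> 1\<close>, where the formula for \<open>p\<close> is
    valid.\<close>
  have "\<rho> 1 > 6 / 5"
    using \<open>s \<ge> 1\<close> by (simp add: \<rho>_def)
  then have "m > 1"
    using m anti[of m 1] by (cases "m \<le> 1") auto
  define lo where "lo = m - 1"
  have lo: "lo \<ge> 1" "\<rho> lo \<ge> 6 / 5"
    using \<open>m > 1\<close> not_less_Least[of lo "\<lambda>j. \<rho> j < 6 / 5"] by (auto simp: lo_def m_def)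
  have gt_lo: "\<rho> j < 6 / 5" if "j > lo" for j
  proof -
    have "m \<le> j"
      using that \<open>m > 1\<close> by (simp add: lo_def)
    then show ?thesis
      using m anti[of m j] by linarith
  qed
  have "hi \<ge> 1"
    using hi(1) \<open>s \<ge> 1\<close> by (cases hi) (auto simp: \<rho>_def)
  define Good where "Good = {X. \<not> mostly_empty T U X lo \<and> mostly_empty T U X hi}"
  have "measure_pmf.prob M {X. mostly_empty T U X lo} \<le> 1 / 6"
    unfolding M_def using lo D(1) by (intro prob_mostly_empty p T) (auto simp: U_def \<rho>_def s_def)
  moreover have "measure_pmf.prob M {X. \<not> mostly_empty T U X hi} \<le> 1 / 6"
    unfolding M_def using hi \<open>hi \<ge> 1\<close> D(1) by (intro prob_mostly_empty p T) (auto simp: U_def \<rho>_def s_def)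
  moreover have "measure_pmf.prob M (- Good) \<le>
      measure_pmf.prob M {X. mostly_empty T U X lo} + measure_pmf.prob M {X. \<not> mostly_empty T U X hi}"
  proof -
    have "- Good = {X. mostly_empty T U X lo} \<union> {X. \<not> mostly_empty T U X hi}"
      by (auto simp: Good_def)
    then show ?thesis
      by (simp add: measure_Un_le)
  qed
  moreover have "measure_pmf.prob M (- Good) = 1 - measure_pmf.prob M Good"
    using measure_pmf.prob_compl[of Good M] by (simp add: Compl_eq_Diff_UNIV)
  ultimately have "2 / 3 \<le> measure_pmf.prob M Good"
    by linarith
  also have "\<dots> \<le> measure_pmf.prob (bind_pmf M (\<lambda>X. run D (support_search n k T d X))) G"
  proof (rule measure_bind_pmf_ge)
    fix X assume "X \<in> Good"
    then have X: "\<not> mostly_empty T (set_pmf D) X lo" "mostly_empty T (set_pmf D) X hi"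
      by (auto simp: Good_def U_def)
    have "\<exists>N. within_factor (6 / 5) s N \<and> run D (support_search n k T d X) = return_pmf N"
      by (rule run_support_search[where lo = lo and hi = hi])
        (use D T hi X less_hi gt_lo in \<open>auto simp: s_def U_def \<rho>_def\<close>)
    then show "set_pmf (run D (support_search n k T d X)) \<subseteq> G"
      by (auto simp: G_def)
  qed
  also have "bind_pmf M (\<lambda>X. run D (support_search n k T d X)) =
      run D (Random (map_pmf (support_search n k T d) M))"
    by (simp add: map_pmf_comp bind_eq_join_pmf)
  finally show ?thesis
    unfolding G_def M_def s_def U_def .
qed

text \<open>Since \<open>10 / 11 \<le> exp (- 1 / 11)\<close>, it is enough that
  \<open>2 ^ d \<ge> 11 * ln (3 * n)\<close>: the quantity is then at most \<open>2 / 3\<close>.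
  Such a \<open>d\<close> is of order \<open>log log n\<close>.\<close>

lemma ex_search_depth:
  "\<exists>C>0. \<forall>n::nat. n \<ge> 1 \<longrightarrow> (\<exists>d::nat. real n * (2 * (10 / 11) ^ 2 ^ d) \<le> 11 / 12 \<and>
     (n \<ge> 3 \<longrightarrow> real d \<le> C * ln (ln (real n))))"
proof -
  have "ln 3 > (1::real)"
    by (rule ln3_gt_1)
  then have "ln (ln 3) > (0::real)"
    by simp
  \<comment> \<open>The bound obtained is \<open>(ln 44 + ln (ln n)) / ln 2\<close>; the constant
    \<open>ln 44\<close> is absorbed using \<open>ln (ln n) \<ge> ln (ln 3) > 0\<close>.\<close>
  define C :: real where "C = (ln 44 / ln (ln 3) + 1) / ln 2"
  have "C > 0"
    using \<open>ln (ln 3) > 0\<close> by (auto simp: C_def intro!: divide_pos_pos add_nonneg_pos)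
  moreover have "\<exists>d::nat. real n * (2 * (10 / 11) ^ 2 ^ d) \<le> 11 / 12 \<and>
      (n \<ge> 3 \<longrightarrow> real d \<le> C * ln (ln (real n)))" if "n \<ge> 1" for n :: nat
  proof -
    define y where "y = ln (3 * real n)"
    have y: "y = ln 3 + ln (real n)"
      using that by (simp add: y_def ln_mult)
    have "y \<ge> 1"
      using \<open>ln 3 > 1\<close> ln_ge_zero[of "real n"] that unfolding y by linarith
    define d where "d = nat \<lceil>log 2 (11 * y)\<rceil>"
    have "log 2 (11 * y) \<ge> 0"
      using \<open>y \<ge> 1\<close> by simp
    then have d: "log 2 (11 * y) \<le> real d" "real d \<le> log 2 (11 * y) + 1"
      by (auto simp: d_def; linarith)+
    have "11 * y = 2 powr log 2 (11 * y)"
      using \<open>y \<ge> 1\<close> by simp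
    also have "\<dots> \<le> 2 powr real d"
      using d(1) by (intro powr_mono) auto
    finally have "11 * y \<le> 2 ^ d"
      by (simp add: powr_realpow)
    have "(10 / 11 :: real) ^ 2 ^ d \<le> exp (- 1 / 11) ^ 2 ^ d"
      using exp_ge_add_one_self[of "- 1 / 11 :: real"] by (intro power_mono) auto
    also have "\<dots> = exp (- (2 ^ d / 11))"
      by (simp add: exp_of_nat_mult[symmetric])
    also have "\<dots> \<le> exp (- y)"
      using \<open>11 * y \<le> 2 ^ d\<close> by simp
    also have "\<dots> = 1 / (3 * real n)"
      using that by (simp add: y_def exp_minus field_simps)
    finally have "real n * (2 * (10 / 11) ^ 2 ^ d) \<le> real n * (2 * (1 / (3 * real n)))"
      by (intro mult_left_mono) auto
    also have "\<dots> \<le> 11 / 12"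
      using that by simp
    finally have small: "real n * (2 * (10 / 11) ^ 2 ^ d) \<le> 11 / 12" .
    have "real d \<le> C * ln (ln (real n))" if "n \<ge> 3"
    proof -
      have "ln (real n) \<ge> ln 3"
        using that by simp
      then have "ln (ln 3) \<le> ln (ln (real n))"
        using \<open>ln 3 > 1\<close> by simp
      \<comment> \<open>Rounding up costs a factor \<open>2\<close> inside the logarithm and
        \<open>y \<le> 2 * ln (real n)\<close> another, whence \<open>44\<close>.\<close>
      have "real d \<le> log 2 (11 * y) + log 2 2"
        using d(2) by simp
      also have "\<dots> = log 2 (22 * y)"
        using log_mult[of 2 "11 * y" 2] \<open>y \<ge> 1\<close> by simp
      also have "\<dots> \<le> log 2 (44 * ln (real n))"
        using \<open>ln (real n) \<ge> ln 3\<close> \<open>y \<ge> 1\<close> by (simp add: y)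
      also have "\<dots> = (ln 44 + ln (ln (real n))) / ln 2"
        using \<open>ln (real n) \<ge> ln 3\<close> \<open>ln 3 > 1\<close> by (simp add: log_def ln_mult)
      also have "ln 44 \<le> ln 44 / ln (ln 3) * ln (ln (real n))"
        using \<open>ln (ln 3) \<le> ln (ln (real n))\<close> \<open>ln (ln 3) > 0\<close> by (simp add: field_simps)
      finally show ?thesis
        by (simp add: C_def field_simps)
    qed
    with small show ?thesis
      by blast
  qed
  ultimately show ?thesis
    by blast
qed

theorem theorem5p2:
  "\<exists>C>0. \<forall>n k :: nat. 1 \<le> k \<and> k \<le> n \<longrightarrow>
     (\<exists>A q. cond_algorithm n k q A \<and>
        (n \<ge> 3 \<longrightarrow> real q \<le> C * (real n * ln (ln (real n)) / real k)) \<and>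
        (\<forall>D :: nat pmf. set_pmf D \<subseteq> {1..n} \<longrightarrow>
           measure_pmf.prob (run D A) {N. within_factor (6/5) (real (card (set_pmf D))) N} \<ge> 2/3))"
proof -
  obtain C where "C > 0" and C: "\<And>n::nat. n \<ge> 1 \<Longrightarrow>
      \<exists>d::nat. real n * (2 * (10 / 11) ^ 2 ^ d) \<le> 11 / 12 \<and>
        (n \<ge> 3 \<longrightarrow> real d \<le> C * ln (ln (real n)))"
    using ex_search_depth by blast
  obtain p where p: "\<And>j. j \<ge> 1 \<Longrightarrow> measure_pmf.prob p {..<j} = exp (- (2 * (10 / 11) ^ j))"
    using ex_level_pmf[of "10 / 11" 2] by auto
  define T :: nat where "T = 3888"
  show ?thesis
  \<comment> \<open>There are \<open>d\<close> rounds of \<open>T\<close> copies with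
    \<open>Suc (n div k)\<close> blocks each; the factor \<open>2\<close> comes from
    \<open>Suc (n div k) \<le> 2 * n / k\<close>, as \<open>k \<le> n\<close>.\<close>
  proof (intro exI[of _ "2 * real T * C"] conjI allI impI)
    show "0 < 2 * real T * C"
      using \<open>C > 0\<close> by (simp add: T_def)
    fix n k :: nat
    assume nk: "1 \<le> k \<and> k \<le> n"
    obtain d where d: "real n * (2 * (10 / 11) ^ 2 ^ d) \<le> 11 / 12"
        "n \<ge> 3 \<Longrightarrow> real d \<le> C * ln (ln (real n))"
      using C[of n] nk by auto
    define A where "A = Random (map_pmf (support_search n k T d) (level_seeds n T p))"
    define q where "q = d * (T * Suc (n div k))"
    have "cond_algorithm n k q A"
      unfolding A_def q_def
      by (intro cond_algorithm.Random) (auto simp del: mult_Suc_right intro: cond_algorithm_support_search)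
    moreover have "real q \<le> 2 * real T * C * (real n * ln (ln (real n)) / real k)" if "n \<ge> 3"
    proof -
      have "real (n div k) \<le> real n / real k"
        by (rule of_nat_div_le_of_nat)
      moreover have "1 \<le> real n / real k"
        using nk by simp
      ultimately have "real (Suc (n div k)) \<le> 2 * (real n / real k)"
        by simp
      then have "real d * (real T * real (Suc (n div k))) \<le>
          (C * ln (ln (real n))) * (real T * (2 * (real n / real k)))"
        using d(2)[OF that] order_trans[OF of_nat_0_le_iff d(2)[OF that]]
        by (intro mult_mono) auto
      then show ?thesis
        unfolding q_def of_nat_mult by (simp only: mult_ac times_divide_eq_right times_divide_eq_left)
    qed
    moreover have "measure_pmf.prob (run D A)
        {N. within_factor (6/5) (real (card (set_pmf D))) N} \<ge> 2/3" if "set_pmf D \<subseteq> {1..n}" for D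
      unfolding A_def by (rule prob_run_support_search[OF p that _ T_def d(1)]) (use nk in auto)
    ultimately show "\<exists>A q. cond_algorithm n k q A \<and>
        (n \<ge> 3 \<longrightarrow> real q \<le> 2 * real T * C * (real n * ln (ln (real n)) / real k)) \<and>
        (\<forall>D :: nat pmf. set_pmf D \<subseteq> {1..n} \<longrightarrow>
           measure_pmf.prob (run D A) {N. within_factor (6/5) (real (card (set_pmf D))) N} \<ge> 2/3)"
      by blast
  qed
qed

end
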